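(* Let $\mathcal A$ be a subvariety of the variety $\mathcal{MTL}$ of MTL-algebras. If $A$ is an absolute retract in $\mathcal A$, then $A$ has a principal unity.
   Context: A residuated lattice is an algebra $\langle A,\wedge,\vee,\odot,\rightarrow,0,1\rangle$ of type $\langle2,2,2,2,0,0\rangle$ such that $\langle A,\odot,1\rangle$ is a commutative monoid, $\langle A,\vee,\wedge,0,1\rangle$ is a bounded lattice (order $\le$), and $a\odot b\le c$ iff $a\le b\rightarrow c$. An MTL-algebra is a residuated lattice satisfying $(x\rightarrow y)\vee(y\rightarrow x)=1$. Put $\neg x=x\rightarrow0$, $a^1=a$, $a^{n+1}=a^n\odot a$. An element $a$ is nilpotent if $a^n=0$ for some $n$, and a unity if $\neg(a^n)$ is nilpotent for every $n\ge1$. $Rad(A)$ is the set of unities of $A$ (equivalently, the intersection of the maximal proper implicative filters). A principal unity of $A$ is a least element $e$ of $Rad(A)$, i.e. $Rad(A)=\{x\in A:x\ge e\}$. $A\in\mathcal A$ is an absolute retract in $\mathcal A$ if for every $B\in\mathcal A$ and every injective homomorphism $i:A\to B$ there is a homomorphism $r:B\to A$ with $r\circ i=1_A$. *)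

theory Defs
  imports "HOL-Algebra.Group" "HOL-Library.Equipollence"
begin

text \<open>
  Algebras of type (2,2,2,2,0,0) with an explicit carrier. The monoid fields
  \<open>mult\<close> and \<open>one\<close> are the product and the top element 1.
\<close>

record 'a rl_alg = "'a monoid" +
  rl_meet :: "'a \<Rightarrow> 'a \<Rightarrow> 'a" (infixl "\<curlywedge>\<index>" 70)
  rl_join :: "'a \<Rightarrow> 'a \<Rightarrow> 'a" (infixl "\<curlyvee>\<index>" 65)
  rl_imp :: "'a \<Rightarrow> 'a \<Rightarrow> 'a" (infixr "\<Rrightarrow>\<index>" 60)
  rl_zero :: 'a ("\<bottom>\<^sub>R\<index>")

definition rl_le :: "'a rl_alg \<Rightarrow> 'a \<Rightarrow> 'a \<Rightarrow> bool" (infix "\<preceq>\<index>" 50)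
  where "x \<preceq>\<^bsub>A\<^esub> y \<longleftrightarrow> x \<curlywedge>\<^bsub>A\<^esub> y = x"

definition rl_neg :: "'a rl_alg \<Rightarrow> 'a \<Rightarrow> 'a"
  where "rl_neg A x = x \<Rrightarrow>\<^bsub>A\<^esub> \<bottom>\<^sub>R\<^bsub>A\<^esub>"

text \<open>The trivial algebra, in which 0 = 1, is not excluded.\<close>

locale residuated_lattice = comm_monoid A for A :: "'a rl_alg" (structure) +
  assumes meet_closed: "\<lbrakk>x \<in> carrier A; y \<in> carrier A\<rbrakk> \<Longrightarrow> x \<curlywedge> y \<in> carrier A"
    and join_closed: "\<lbrakk>x \<in> carrier A; y \<in> carrier A\<rbrakk> \<Longrightarrow> x \<curlyvee> y \<in> carrier A"
    and imp_closed: "\<lbrakk>x \<in> carrier A; y \<in> carrier A\<rbrakk> \<Longrightarrow> x \<Rrightarrow> y \<in> carrier A"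
    and zero_closed: "\<bottom>\<^sub>R \<in> carrier A"
    and meet_comm: "\<lbrakk>x \<in> carrier A; y \<in> carrier A\<rbrakk> \<Longrightarrow> x \<curlywedge> y = y \<curlywedge> x"
    and join_comm: "\<lbrakk>x \<in> carrier A; y \<in> carrier A\<rbrakk> \<Longrightarrow> x \<curlyvee> y = y \<curlyvee> x"
    and meet_assoc: "\<lbrakk>x \<in> carrier A; y \<in> carrier A; z \<in> carrier A\<rbrakk>
      \<Longrightarrow> (x \<curlywedge> y) \<curlywedge> z = x \<curlywedge> (y \<curlywedge> z)"
    and join_assoc: "\<lbrakk>x \<in> carrier A; y \<in> carrier A; z \<in> carrier A\<rbrakk>
      \<Longrightarrow> (x \<curlyvee> y) \<curlyvee> z = x \<curlyvee> (y \<curlyvee> z)"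
    and meet_join_absorb: "\<lbrakk>x \<in> carrier A; y \<in> carrier A\<rbrakk> \<Longrightarrow> x \<curlywedge> (x \<curlyvee> y) = x"
    and join_meet_absorb: "\<lbrakk>x \<in> carrier A; y \<in> carrier A\<rbrakk> \<Longrightarrow> x \<curlyvee> (x \<curlywedge> y) = x"
    and zero_least: "x \<in> carrier A \<Longrightarrow> \<bottom>\<^sub>R \<preceq> x"
    and one_greatest: "x \<in> carrier A \<Longrightarrow> x \<preceq> \<one>"
    and residuation: "\<lbrakk>x \<in> carrier A; y \<in> carrier A; z \<in> carrier A\<rbrakk>
      \<Longrightarrow> x \<otimes> y \<preceq> z \<longleftrightarrow> x \<preceq> (y \<Rrightarrow> z)"

locale mtl_algebra = residuated_lattice +
  assumes prelinearity: "\<lbrakk>x \<in> carrier A; y \<in> carrier A\<rbrakk>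
    \<Longrightarrow> (x \<Rrightarrow> y) \<curlyvee> (y \<Rrightarrow> x) = \<one>"

definition nilpotent :: "'a rl_alg \<Rightarrow> 'a \<Rightarrow> bool"
  where "nilpotent A a \<longleftrightarrow> (\<exists>n::nat. n \<ge> 1 \<and> a [^]\<^bsub>A\<^esub> n = \<bottom>\<^sub>R\<^bsub>A\<^esub>)"

definition is_unity :: "'a rl_alg \<Rightarrow> 'a \<Rightarrow> bool"
  where "is_unity A a \<longleftrightarrow> (\<forall>n::nat. n \<ge> 1 \<longrightarrow> nilpotent A (rl_neg A (a [^]\<^bsub>A\<^esub> n)))"

definition Rad :: "'a rl_alg \<Rightarrow> 'a set"
  where "Rad A = {a \<in> carrier A. is_unity A a}"

definition principal_unity :: "'a rl_alg \<Rightarrow> 'a \<Rightarrow> bool"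
  where "principal_unity A e \<longleftrightarrow> e \<in> Rad A \<and> Rad A = {x \<in> carrier A. e \<preceq>\<^bsub>A\<^esub> x}"

definition rl_hom :: "'a rl_alg \<Rightarrow> 'b rl_alg \<Rightarrow> ('a \<Rightarrow> 'b) set"
  where "rl_hom A B = {h \<in> hom A B.
    h \<one>\<^bsub>A\<^esub> = \<one>\<^bsub>B\<^esub> \<and> h \<bottom>\<^sub>R\<^bsub>A\<^esub> = \<bottom>\<^sub>R\<^bsub>B\<^esub> \<and>
    (\<forall>x\<in>carrier A. \<forall>y\<in>carrier A.
      h (x \<curlywedge>\<^bsub>A\<^esub> y) = h x \<curlywedge>\<^bsub>B\<^esub> h y \<and>
      h (x \<curlyvee>\<^bsub>A\<^esub> y) = h x \<curlyvee>\<^bsub>B\<^esub> h y \<and>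
      h (x \<Rrightarrow>\<^bsub>A\<^esub> y) = h x \<Rrightarrow>\<^bsub>B\<^esub> h y)}"

datatype rl_term =
    TVar nat
  | TZero
  | TOne
  | TMeet rl_term rl_term
  | TJoin rl_term rl_term
  | TMult rl_term rl_term
  | TImp rl_term rl_term

primrec rl_eval :: "'a rl_alg \<Rightarrow> (nat \<Rightarrow> 'a) \<Rightarrow> rl_term \<Rightarrow> 'a" where
  "rl_eval A v (TVar n) = v n"
| "rl_eval A v TZero = \<bottom>\<^sub>R\<^bsub>A\<^esub>"
| "rl_eval A v TOne = \<one>\<^bsub>A\<^esub>"
| "rl_eval A v (TMeet s t) = rl_eval A v s \<curlywedge>\<^bsub>A\<^esub> rl_eval A v t"
| "rl_eval A v (TJoin s t) = rl_eval A v s \<curlyvee>\<^bsub>A\<^esub> rl_eval A v t"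
| "rl_eval A v (TMult s t) = rl_eval A v s \<otimes>\<^bsub>A\<^esub> rl_eval A v t"
| "rl_eval A v (TImp s t) = rl_eval A v s \<Rrightarrow>\<^bsub>A\<^esub> rl_eval A v t"

definition satisfies :: "'a rl_alg \<Rightarrow> (rl_term \<times> rl_term) set \<Rightarrow> bool"
  where "satisfies A E \<longleftrightarrow>
    (\<forall>(s, t)\<in>E. \<forall>v \<in> UNIV \<rightarrow> carrier A. rl_eval A v s = rl_eval A v t)"

text \<open>
  A subvariety of MTL is an equational subclass of MTL, so it is given by a set \<open>E\<close> of
  identities, and every such \<open>E\<close> determines a subvariety. Unlike a predicate on
  algebras, \<open>E\<close> determines the subvariety for carriers of every type at once.
\<close>

definition in_subvariety :: "(rl_term \<times> rl_term) set \<Rightarrow> 'a rl_alg \<Rightarrow> bool"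
  where "in_subvariety E A \<longleftrightarrow> mtl_algebra A \<and> satisfies A E"

text \<open>
  A HOL formula cannot quantify over types, so the type \<open>'b\<close> in which the carriers of the
  extensions \<open>B\<close> live is a parameter, playing the part of a universe. It has to be taken
  large enough: if \<open>A\<close> does not embed into any algebra over \<open>'b\<close>, the condition is void.
\<close>

definition absolute_retract ::
    "'b itself \<Rightarrow> (rl_term \<times> rl_term) set \<Rightarrow> 'a rl_alg \<Rightarrow> bool"
  where "absolute_retract (_ :: 'b itself) E A \<longleftrightarrow> in_subvariety E A \<and>
    (\<forall>(B :: 'b rl_alg) i. in_subvariety E B \<and> i \<in> rl_hom A B \<and> inj_on i (carrier A) \<longrightarrow>
      (\<exists>r \<in> rl_hom B A. \<forall>x\<in>carrier A. r (i x) = x))"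

end

theory Submission
  imports Defs
begin

text \<open>
  If \<open>A\<close> embeds into some \<open>B\<close> in the subvariety that has a unity \<open>u\<close> below the images of all
  unities of \<open>A\<close>, then a retraction \<open>B \<rightarrow> A\<close> sends \<open>u\<close> to a unity of \<open>A\<close> below all unities, that
  is, to a principal unity. By prelinearity \<open>a\<close> is a unity iff \<open>(\<not>(a\<^sup>n))\<^sup>2 = 0\<close> for all \<open>n \<ge> 1\<close>,
  hence \<open>Rad A\<close> is closed under products and therefore down-directed. So \<open>B\<close> can be taken as an
  algebra of germs of functions \<open>Rad A \<rightarrow> A\<close> along the filter generated by the sets
  \<open>{x \<in> Rad A. x \<le> a}\<close>, with \<open>u\<close> the germ of the identity. The germs of unary polynomial
  functions suffice, and there are at most \<open>max \<bar>A\<bar> \<aleph>\<^sub>0\<close> of them.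
\<close>

section \<open>Order, product and unities in residuated lattices\<close>

context residuated_lattice
begin

lemma neg_closed [intro, simp]: "x \<in> carrier A \<Longrightarrow> rl_neg A x \<in> carrier A"
  unfolding rl_neg_def by (intro imp_closed zero_closed)

lemma meet_idem: "x \<in> carrier A \<Longrightarrow> x \<curlywedge> x = x"
  by (metis meet_join_absorb join_meet_absorb meet_closed)

lemma le_refl [simp]: "x \<in> carrier A \<Longrightarrow> x \<preceq> x"
  unfolding rl_le_def by (rule meet_idem)

lemma le_trans:
  "\<lbrakk>x \<preceq> y; y \<preceq> z; x \<in> carrier A; y \<in> carrier A; z \<in> carrier A\<rbrakk> \<Longrightarrow> x \<preceq> z"
  unfolding rl_le_def by (metis meet_assoc)

lemma le_antisym: "\<lbrakk>x \<preceq> y; y \<preceq> x; x \<in> carrier A; y \<in> carrier A\<rbrakk> \<Longrightarrow> x = y"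
  unfolding rl_le_def by (metis meet_comm)

lemma le_zero_iff: "x \<in> carrier A \<Longrightarrow> x \<preceq> \<bottom>\<^sub>R \<longleftrightarrow> x = \<bottom>\<^sub>R"
  using le_antisym zero_closed zero_least le_refl by blast

lemma one_le_iff: "x \<in> carrier A \<Longrightarrow> \<one> \<preceq> x \<longleftrightarrow> x = \<one>"
  using le_antisym one_closed one_greatest le_refl by blast

lemma le_iff_join: "\<lbrakk>x \<in> carrier A; y \<in> carrier A\<rbrakk> \<Longrightarrow> x \<preceq> y \<longleftrightarrow> x \<curlyvee> y = y"
  unfolding rl_le_def by (metis meet_comm join_comm join_meet_absorb meet_join_absorb)

lemma join_upper1: "\<lbrakk>x \<in> carrier A; y \<in> carrier A\<rbrakk> \<Longrightarrow> x \<preceq> x \<curlyvee> y"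
  unfolding rl_le_def by (rule meet_join_absorb)

lemma join_upper2: "\<lbrakk>x \<in> carrier A; y \<in> carrier A\<rbrakk> \<Longrightarrow> y \<preceq> x \<curlyvee> y"
  using join_upper1 join_comm by metis

lemma join_least:
  "\<lbrakk>x \<preceq> z; y \<preceq> z; x \<in> carrier A; y \<in> carrier A; z \<in> carrier A\<rbrakk> \<Longrightarrow> x \<curlyvee> y \<preceq> z"
  by (metis le_iff_join join_assoc join_closed)

text \<open>Residuation gives \<open>y \<preceq> z \<Rrightarrow> y \<otimes> z\<close>, and
  transitivity replaces \<open>y\<close> by \<open>x\<close> on the left.\<close>

lemma mult_right_mono:
  assumes "x \<preceq> y" and [simp]: "x \<in> carrier A" "y \<in> carrier A" "z \<in> carrier A"
  shows "x \<otimes> z \<preceq> y \<otimes> z"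
proof -
  have "y \<preceq> z \<Rrightarrow> y \<otimes> z"
    using residuation[of y z "y \<otimes> z"] by simp
  then have "x \<preceq> z \<Rrightarrow> y \<otimes> z"
    using le_trans[OF assms(1)] by (simp add: imp_closed)
  then show ?thesis
    using residuation[of x z "y \<otimes> z"] by simp
qed

lemma mult_mono:
  assumes "x \<preceq> y" "z \<preceq> w"
    and [simp]: "x \<in> carrier A" "y \<in> carrier A" "z \<in> carrier A" "w \<in> carrier A"
  shows "x \<otimes> z \<preceq> y \<otimes> w"
proof -
  have "x \<otimes> z \<preceq> y \<otimes> z" "z \<otimes> y \<preceq> w \<otimes> y"
    using assms by (auto intro: mult_right_mono)
  then show ?thesis
    using le_trans by (simp add: m_comm)
qed

lemma mult_le_left: "\<lbrakk>x \<in> carrier A; y \<in> carrier A\<rbrakk> \<Longrightarrow> x \<otimes> y \<preceq> x"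
  using mult_mono[of x x y \<one>] by (simp add: one_greatest)

lemma mult_le_right: "\<lbrakk>x \<in> carrier A; y \<in> carrier A\<rbrakk> \<Longrightarrow> x \<otimes> y \<preceq> y"
  using mult_le_left[of y x] by (simp add: m_comm)

lemma nat_pow_mono:
  "\<lbrakk>x \<preceq> y; x \<in> carrier A; y \<in> carrier A\<rbrakk> \<Longrightarrow> x [^] (n::nat) \<preceq> y [^] n"
  by (induction n) (auto intro: mult_mono)

text \<open>Having a residual, the product distributes over joins. Of the four products on the left,
  three contain the factor \<open>x\<close> and lie below \<open>x\<close>; the fourth is
  \<open>y \<otimes> z\<close>.\<close>

lemma join_mult_le:
  assumes [simp]: "x \<in> carrier A" "y \<in> carrier A" "z \<in> carrier A"
  shows "(x \<curlyvee> y) \<otimes> (x \<curlyvee> z) \<preceq> x \<curlyvee> (y \<otimes> z)"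
proof -
  note [simp] = join_closed imp_closed
  let ?d = "x \<curlyvee> (y \<otimes> z)"
  have xd: "x \<preceq> ?d" and yz: "y \<otimes> z \<preceq> ?d"
    by (simp_all add: join_upper1 join_upper2)
  have "x \<otimes> y \<preceq> ?d"
    using le_trans[OF mult_le_left xd] by simp
  then have "x \<preceq> y \<Rrightarrow> ?d" "z \<preceq> y \<Rrightarrow> ?d"
    using yz residuation[of x y ?d] residuation[of z y ?d] by (auto simp: m_comm)
  then have "(x \<curlyvee> z) \<preceq> y \<Rrightarrow> ?d"
    by (intro join_least) auto
  then have "(x \<curlyvee> z) \<otimes> y \<preceq> ?d"
    using residuation[of "x \<curlyvee> z" y ?d] by simp
  then have "y \<preceq> (x \<curlyvee> z) \<Rrightarrow> ?d"
    using residuation[of y "x \<curlyvee> z" ?d] by (simp add: m_comm)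
  moreover have "x \<otimes> (x \<curlyvee> z) \<preceq> ?d"
    using le_trans[OF mult_le_left xd] by simp
  then have "x \<preceq> (x \<curlyvee> z) \<Rrightarrow> ?d"
    using residuation[of x "x \<curlyvee> z" ?d] by simp
  ultimately have "(x \<curlyvee> y) \<preceq> (x \<curlyvee> z) \<Rrightarrow> ?d"
    by (intro join_least) auto
  then show ?thesis
    using residuation[of "x \<curlyvee> y" "x \<curlyvee> z" ?d] by simp
qed

text \<open>Multiplying \<open>x \<curlyvee> y [^] n = \<one>\<close> by
  \<open>x \<curlyvee> y = \<one>\<close> raises the exponent by one. This lets a nilpotent
  \<open>y\<close> be dropped from such a join.\<close>

lemma join_pow_eq_one:
  assumes "x \<curlyvee> y = \<one>" and [simp]: "x \<in> carrier A" "y \<in> carrier A"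
  shows "x \<curlyvee> y [^] (n::nat) = \<one>"
proof (induction n)
  case 0
  show ?case
    using join_upper2[of x \<one>] by (simp add: one_le_iff join_closed)
next
  case (Suc n)
  then show ?case
    using join_mult_le[of x "y [^] n" y] assms by (simp add: one_le_iff join_closed)
qed

lemma le_neg_iff:
  "\<lbrakk>x \<in> carrier A; y \<in> carrier A\<rbrakk> \<Longrightarrow> x \<preceq> rl_neg A y \<longleftrightarrow> x \<otimes> y = \<bottom>\<^sub>R"
  unfolding rl_neg_def using residuation[of x y "\<bottom>\<^sub>R"]
  by (simp add: zero_closed le_zero_iff)

lemma nilpotent_antimono:
  assumes "nilpotent A y" "x \<preceq> y" "x \<in> carrier A" "y \<in> carrier A"
  shows "nilpotent A x"
  using assms nat_pow_mono unfolding nilpotent_def by (metis le_zero_iff nat_pow_closed)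

lemma nilpotent_pow:
  assumes "nilpotent A (x [^] (m::nat))" "m \<ge> 1" "x \<in> carrier A"
  shows "nilpotent A x"
  using assms unfolding nilpotent_def by (metis nat_pow_pow mult_le_mono nat_mult_1)

text \<open>Powers are monotone, negation is antitone, and nilpotency passes to smaller elements.
  Hence a least unity generates \<open>Rad A\<close> as an up-set.\<close>

lemma is_unity_mono:
  assumes "is_unity A x" "x \<preceq> y" and [simp]: "x \<in> carrier A" "y \<in> carrier A"
  shows "is_unity A y"
  unfolding is_unity_def
proof (intro allI impI)
  fix n :: nat
  assume "n \<ge> 1"
  have "rl_neg A (y [^] n) \<otimes> x [^] n \<preceq> rl_neg A (y [^] n) \<otimes> y [^] n"
    using assms by (intro mult_mono nat_pow_mono) auto
  also have "rl_neg A (y [^] n) \<otimes> y [^] n = \<bottom>\<^sub>R"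
    using le_neg_iff[of "rl_neg A (y [^] n)" "y [^] n"] by simp
  finally have "rl_neg A (y [^] n) \<preceq> rl_neg A (x [^] n)"
    by (simp add: le_neg_iff le_zero_iff)
  moreover have "nilpotent A (rl_neg A (x [^] n))"
    using assms \<open>n \<ge> 1\<close> unfolding is_unity_def by blast
  ultimately show "nilpotent A (rl_neg A (y [^] n))"
    using nilpotent_antimono by simp
qed

lemma one_in_Rad: "\<one> \<in> Rad A"
proof -
  have "rl_neg A \<one> = \<bottom>\<^sub>R"
    using le_neg_iff[of "rl_neg A \<one>" \<one>] by simp
  then show ?thesis
    unfolding Rad_def is_unity_def nilpotent_def
    by (auto intro!: exI[of _ 1] simp: zero_closed)
qed

end

section \<open>Unities under prelinearity, and their images under homomorphisms\<close>

context mtl_algebra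
begin

text \<open>Prelinearity makes \<open>?s \<curlyvee> ?t\<close> equal to 1. Since \<open>?t\<close>
  turns out to be nilpotent, \<open>?s\<close> alone is 1, which says that \<open>?b\<close> lies
  below its own negation.\<close>

lemma unity_neg_square_zero:
  assumes u: "is_unity A a" and [simp]: "a \<in> carrier A" and n: "n \<ge> (1::nat)"
  shows "rl_neg A (a [^] n) \<otimes> rl_neg A (a [^] n) = \<bottom>\<^sub>R"
proof -
  note [simp] = imp_closed
  let ?b = "rl_neg A (a [^] n)"
  let ?s = "?b \<Rrightarrow> rl_neg A ?b" and ?t = "rl_neg A ?b \<Rrightarrow> ?b"
  obtain m :: nat where m: "m \<ge> 1" "?b [^] m = \<bottom>\<^sub>R"
    using u n unfolding is_unity_def nilpotent_def by blast
  have "?b \<otimes> a [^] n = \<bottom>\<^sub>R"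
    using le_neg_iff[of ?b "a [^] n"] by simp
  then have "a [^] n \<preceq> rl_neg A ?b"
    by (simp add: le_neg_iff m_comm)
  then have "?t \<otimes> a [^] n \<preceq> ?t \<otimes> rl_neg A ?b"
    by (intro mult_mono) auto
  moreover have "?t \<otimes> rl_neg A ?b \<preceq> ?b"
    using residuation[of ?t "rl_neg A ?b" ?b] by simp
  ultimately have "?t \<otimes> a [^] n \<preceq> ?b"
    by (rule le_trans) auto
  \<comment> \<open>The right side is 0, so \<open>?t [^] m\<close> annihilates the power of
    \<open>a\<close> with exponent \<open>n * m\<close>, whose negation is nilpotent because
    \<open>a\<close> is a unity.\<close>
  then have "(?t \<otimes> a [^] n) [^] m \<preceq> ?b [^] m"
    by (intro nat_pow_mono) auto
  then have t_le: "?t [^] m \<preceq> rl_neg A (a [^] (n * m))"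
    using m by (simp add: le_neg_iff le_zero_iff nat_pow_distrib nat_pow_pow)
  have "nilpotent A (rl_neg A (a [^] (n * m)))"
    using u n m unfolding is_unity_def by (metis mult_le_mono nat_mult_1)
  then have "nilpotent A (?t [^] m)"
    using t_le by (rule nilpotent_antimono) auto
  then have "nilpotent A ?t"
    using m(1) by (rule nilpotent_pow) simp
  then obtain k :: nat where "?t [^] k = \<bottom>\<^sub>R"
    unfolding nilpotent_def by blast
  moreover have "?s \<curlyvee> ?t [^] k = \<one>"
    by (intro join_pow_eq_one prelinearity) auto
  ultimately have "?s = \<one>"
    using zero_least[of ?s] by (simp add: le_iff_join zero_closed join_comm)
  then show ?thesis
    using residuation[of \<one> ?b "rl_neg A ?b"] by (simp add: le_neg_iff)
qed

text \<open>Since \<open>?p\<close> annihilates the product of the two powers,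
  \<open>?p \<otimes> a [^] n\<close> lies below the negation of \<open>b [^] n\<close>, whose
  square is 0. Squaring puts \<open>?p [^] 2\<close> below the negation of
  \<open>a [^] (n + n)\<close>, which is nilpotent.\<close>

lemma Rad_mult_closed:
  assumes "a \<in> Rad A" "b \<in> Rad A"
  shows "a \<otimes> b \<in> Rad A"
proof -
  have [simp]: "a \<in> carrier A" "b \<in> carrier A"
    using assms by (auto simp: Rad_def)
  have "nilpotent A (rl_neg A ((a \<otimes> b) [^] n))" if n: "n \<ge> 1" for n :: nat
  proof -
    let ?p = "rl_neg A ((a \<otimes> b) [^] n)"
    have "?p \<otimes> (a [^] n \<otimes> b [^] n) = \<bottom>\<^sub>R"
      using le_neg_iff[of ?p "(a \<otimes> b) [^] n"] by (simp add: nat_pow_distrib)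
    then have "?p \<otimes> a [^] n \<preceq> rl_neg A (b [^] n)"
      by (simp add: le_neg_iff m_assoc)
    then have "(?p \<otimes> a [^] n) \<otimes> (?p \<otimes> a [^] n)
        \<preceq> rl_neg A (b [^] n) \<otimes> rl_neg A (b [^] n)"
      by (intro mult_mono) auto
    then have "(?p \<otimes> a [^] n) \<otimes> (?p \<otimes> a [^] n) = \<bottom>\<^sub>R"
      using unity_neg_square_zero[of b n] assms n by (simp add: Rad_def le_zero_iff)
    then have "?p [^] (2::nat) \<otimes> a [^] (n + n) = \<bottom>\<^sub>R"
      by (simp add: numeral_2_eq_2 m_ac flip: nat_pow_mult)
    then have "?p [^] (2::nat) \<preceq> rl_neg A (a [^] (n + n))"
      by (simp add: le_neg_iff)
    moreover have "nilpotent A (rl_neg A (a [^] (n + n)))"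
      using assms n by (simp add: Rad_def is_unity_def)
    ultimately show ?thesis
      using nilpotent_antimono nilpotent_pow[of ?p 2] by simp
  qed
  then show ?thesis
    by (simp add: Rad_def is_unity_def)
qed

end

text \<open>Being a unity is expressed by equations between terms, so the exponents that work for
  \<open>a\<close> also work for \<open>h a\<close>.\<close>

lemma rl_hom_Rad:
  assumes h: "h \<in> rl_hom A B" and "residuated_lattice A" and a: "a \<in> Rad A"
  shows "h a \<in> Rad B"
proof -
  interpret residuated_lattice A by fact
  have pow: "h (x [^]\<^bsub>A\<^esub> n) = h x [^]\<^bsub>B\<^esub> n" if "x \<in> carrier A" for x and n :: nat
    using that h by (induction n) (auto simp: rl_hom_def hom_def)
  have neg: "h (rl_neg A x) = rl_neg B (h x)" if "x \<in> carrier A" for x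
    using that h by (simp add: rl_hom_def rl_neg_def zero_closed)
  have "h a \<in> carrier B"
    using h a by (auto simp: rl_hom_def hom_def Rad_def)
  moreover have "h \<bottom>\<^sub>R\<^bsub>A\<^esub> = \<bottom>\<^sub>R\<^bsub>B\<^esub>"
    using h by (simp add: rl_hom_def)
  ultimately show ?thesis
    using a unfolding Rad_def is_unity_def nilpotent_def
    by (auto simp flip: pow neg) metis
qed

section \<open>Reduced powers of \<open>A\<close> and their unities\<close>

text \<open>
  A subalgebra \<open>P\<close> of a power of \<open>A\<close>, reduced modulo the filter \<open>F\<close>. The map \<open>h\<close> encodes the
  classes in a prescribed type, since the retraction property of \<open>A\<close> concerns carriers in a
  fixed type only.
\<close>

locale reduced_power = residuated_lattice A for A :: "'a rl_alg" (structure) +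
  fixes F :: "'i filter" and P :: "('i \<Rightarrow> 'a) set" and h :: "('i \<Rightarrow> 'a) \<Rightarrow> 'b"
  assumes P_carrier: "p \<in> P \<Longrightarrow> p i \<in> carrier A"
    and P_const: "a \<in> carrier A \<Longrightarrow> (\<lambda>_. a) \<in> P"
    and P_mult: "\<lbrakk>p \<in> P; q \<in> P\<rbrakk> \<Longrightarrow> (\<lambda>i. p i \<otimes> q i) \<in> P"
    and P_meet: "\<lbrakk>p \<in> P; q \<in> P\<rbrakk> \<Longrightarrow> (\<lambda>i. p i \<curlywedge> q i) \<in> P"
    and P_join: "\<lbrakk>p \<in> P; q \<in> P\<rbrakk> \<Longrightarrow> (\<lambda>i. p i \<curlyvee> q i) \<in> P"
    and P_imp: "\<lbrakk>p \<in> P; q \<in> P\<rbrakk> \<Longrightarrow> (\<lambda>i. p i \<Rrightarrow> q i) \<in> P"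
    and h_eq_iff: "\<lbrakk>p \<in> P; q \<in> P\<rbrakk> \<Longrightarrow> h p = h q \<longleftrightarrow> (\<forall>\<^sub>F i in F. p i = q i)"
begin

text \<open>Elements of the reduced power are mere codes, so the operations of \<open>B\<close>
  first decode them by a choice of representative.\<close>

definition rep :: "'b \<Rightarrow> 'i \<Rightarrow> 'a"
  where "rep b = (SOME p. p \<in> P \<and> h p = b)"

definition B :: "'b rl_alg"
  where "B = \<lparr>carrier = h ` P,
    mult = (\<lambda>x y. h (\<lambda>i. rep x i \<otimes> rep y i)), one = h (\<lambda>_. \<one>),
    rl_meet = (\<lambda>x y. h (\<lambda>i. rep x i \<curlywedge> rep y i)),
    rl_join = (\<lambda>x y. h (\<lambda>i. rep x i \<curlyvee> rep y i)),
    rl_imp = (\<lambda>x y. h (\<lambda>i. rep x i \<Rrightarrow> rep y i)), rl_zero = h (\<lambda>_. \<bottom>\<^sub>R)\<rparr>"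

lemma rep:
  assumes "p \<in> P"
  shows "rep (h p) \<in> P" "\<forall>\<^sub>F i in F. rep (h p) i = p i"
proof -
  have "rep (h p) \<in> P \<and> h (rep (h p)) = h p"
    unfolding rep_def using assms by (intro someI[of "\<lambda>q. q \<in> P \<and> h q = h p"]) simp
  then show "rep (h p) \<in> P" "\<forall>\<^sub>F i in F. rep (h p) i = p i"
    using h_eq_iff assms by auto
qed

lemma carrier_B: "carrier B = h ` P"
  and one_B: "\<one>\<^bsub>B\<^esub> = h (\<lambda>_. \<one>)"
  and zero_B: "\<bottom>\<^sub>R\<^bsub>B\<^esub> = h (\<lambda>_. \<bottom>\<^sub>R)"
  by (simp_all add: B_def)

text \<open>Independence of representatives: two functions that agree along \<open>F\<close> with
  \<open>p\<close> and \<open>q\<close> do so simultaneously along \<open>F\<close>.\<close>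

lemma h_lift:
  assumes "p \<in> P" "q \<in> P" and "\<And>p q. \<lbrakk>p \<in> P; q \<in> P\<rbrakk> \<Longrightarrow> (\<lambda>i. f (p i) (q i)) \<in> P"
  shows "h (\<lambda>i. f (rep (h p) i) (rep (h q) i)) = h (\<lambda>i. f (p i) (q i))"
proof -
  have "\<forall>\<^sub>F i in F. f (rep (h p) i) (rep (h q) i) = f (p i) (q i)"
    using rep(2)[OF assms(1)] rep(2)[OF assms(2)] by eventually_elim simp
  then show ?thesis
    by (subst h_eq_iff) (auto intro!: assms rep(1))
qed

lemma
  assumes "p \<in> P" "q \<in> P"
  shows mult_B: "h p \<otimes>\<^bsub>B\<^esub> h q = h (\<lambda>i. p i \<otimes> q i)"
    and meet_B: "h p \<curlywedge>\<^bsub>B\<^esub> h q = h (\<lambda>i. p i \<curlywedge> q i)"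
    and join_B: "h p \<curlyvee>\<^bsub>B\<^esub> h q = h (\<lambda>i. p i \<curlyvee> q i)"
    and imp_B: "h p \<Rrightarrow>\<^bsub>B\<^esub> h q = h (\<lambda>i. p i \<Rrightarrow> q i)"
  using assms by (simp_all add: B_def h_lift P_mult P_meet P_join P_imp)

lemmas P_closed = P_const P_mult P_meet P_join P_imp
lemmas ops_B = one_B zero_B mult_B meet_B join_B imp_B

lemma le_B: "\<lbrakk>p \<in> P; q \<in> P\<rbrakk> \<Longrightarrow> h p \<preceq>\<^bsub>B\<^esub> h q \<longleftrightarrow> (\<forall>\<^sub>F i in F. p i \<preceq> q i)"
  by (simp add: rl_le_def meet_B h_eq_iff P_meet)

text \<open>All axioms hold index by index. For residuation, the two inequalities hold at the same
  indices, hence one holds along \<open>F\<close> iff the other does.\<close>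

lemma residuated_lattice_B: "residuated_lattice B"
proof -
  note [simp] = carrier_B ops_B le_B P_closed P_carrier zero_closed
  show ?thesis
    by unfold_locales
      (auto simp: m_assoc meet_assoc join_assoc meet_join_absorb join_meet_absorb
        zero_least one_greatest residuation, simp_all add: m_comm meet_comm join_comm)
qed

lemma mtl_algebra_B:
  assumes "mtl_algebra A"
  shows "mtl_algebra B"
proof -
  interpret mtl_algebra A by fact
  interpret B: residuated_lattice B by (rule residuated_lattice_B)
  show ?thesis
    by unfold_locales (auto simp: carrier_B ops_B P_closed P_carrier prelinearity)
qed

lemma eval_B:
  assumes "\<And>n. w n \<in> P"
  shows "(\<lambda>i. rl_eval A (\<lambda>n. w n i) t) \<in> P \<and>
    rl_eval B (\<lambda>n. h (w n)) t = h (\<lambda>i. rl_eval A (\<lambda>n. w n i) t)"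
  by (induction t) (auto simp: assms ops_B P_closed zero_closed)

text \<open>A valuation in \<open>B\<close> lifts to a sequence of functions in \<open>P\<close>; at
  each index these form a valuation in \<open>A\<close>, where the identities hold.\<close>

lemma in_subvariety_B:
  assumes "in_subvariety E A"
  shows "in_subvariety E B"
  unfolding in_subvariety_def satisfies_def
proof (intro conjI ballI, goal_cases)
  case 1
  show ?case
    using assms mtl_algebra_B by (simp add: in_subvariety_def)
next
  case (2 st)
  obtain s t where st: "st = (s, t)" by force
  have "rl_eval B v s = rl_eval B v t" if "v \<in> UNIV \<rightarrow> carrier B" for v
  proof -
    have "\<forall>n. \<exists>p. p \<in> P \<and> v n = h p"
      using that by (auto simp: carrier_B Pi_iff)
    then obtain w where w: "\<And>n. w n \<in> P" "\<And>n. v n = h (w n)"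
      by metis
    have "rl_eval A (\<lambda>n. w n i) s = rl_eval A (\<lambda>n. w n i) t" for i
      using assms 2 w(1) P_carrier st by (fastforce simp: in_subvariety_def satisfies_def)
    moreover have "v = (\<lambda>n. h (w n))"
      using w(2) by blast
    ultimately show ?thesis
      using eval_B[of w] w(1) by simp
  qed
  then show ?case
    by (simp add: st)
qed

lemma const_hom: "(\<lambda>a. h (\<lambda>_. a)) \<in> rl_hom A B"
  by (auto simp: rl_hom_def hom_def ops_B carrier_B P_const)

text \<open>An equation not depending on the index that holds along a proper filter is true.\<close>

lemma inj_on_const: "F \<noteq> bot \<Longrightarrow> inj_on (\<lambda>a. h (\<lambda>_. a)) (carrier A)"
  by (auto intro!: inj_onI simp: h_eq_iff P_const eventually_const_iff)

lemma pow_B: "p \<in> P \<Longrightarrow> (\<lambda>i. p i [^] n) \<in> P \<and> h p [^]\<^bsub>B\<^esub> n = h (\<lambda>i. p i [^] (n::nat))"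
  by (induction n) (auto simp: ops_B P_closed)

lemma neg_B:
  "p \<in> P \<Longrightarrow> (\<lambda>i. rl_neg A (p i)) \<in> P \<and> rl_neg B (h p) = h (\<lambda>i. rl_neg A (p i))"
  by (simp add: rl_neg_def ops_B P_closed zero_closed)

text \<open>This needs the exponents witnessing nilpotency to be bounded uniformly in \<open>i\<close>.\<close>

lemma Rad_B:
  assumes "mtl_algebra A" "p \<in> P" "\<And>i. p i \<in> Rad A"
  shows "h p \<in> Rad B"
proof -
  interpret mtl_algebra A by fact
  interpret B: residuated_lattice B by (rule residuated_lattice_B)
  have "nilpotent B (rl_neg B (h p [^]\<^bsub>B\<^esub> n))" if "n \<ge> 1" for n :: nat
  proof -
    let ?q = "\<lambda>i. rl_neg A (p i [^] n)"
    have q: "?q \<in> P" "rl_neg B (h p [^]\<^bsub>B\<^esub> n) = h ?q"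
      using pow_B[OF assms(2), of n] neg_B[of "\<lambda>i. p i [^] n"] by auto
    \<comment> \<open>The uniform exponent is 2.\<close>
    have "?q i \<otimes> ?q i = \<bottom>\<^sub>R" for i
      using assms(3)[of i] that by (intro unity_neg_square_zero) (auto simp: Rad_def)
    then have "h ?q \<otimes>\<^bsub>B\<^esub> h ?q = \<bottom>\<^sub>R\<^bsub>B\<^esub>"
      using q(1) by (simp add: mult_B zero_B)
    moreover have "h ?q \<in> carrier B"
      using q(1) by (simp add: carrier_B)
    ultimately have "h ?q [^]\<^bsub>B\<^esub> (2::nat) = \<bottom>\<^sub>R\<^bsub>B\<^esub>"
      by (simp add: numeral_2_eq_2)
    then show ?thesis
      unfolding nilpotent_def q(2) by (intro exI[of _ 2]) simp
  qed
  then show ?thesis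
    using assms(2) by (simp add: Rad_def is_unity_def carrier_B)
qed

end

section \<open>Cardinality of generated algebras\<close>

text \<open>Binary operations suffice here: 0 and 1 will enter through the constant functions among
  the generators.\<close>

inductive_set generated :: "('c \<Rightarrow> 'c \<Rightarrow> 'c) set \<Rightarrow> 'c set \<Rightarrow> 'c set"
  for ops :: "('c \<Rightarrow> 'c \<Rightarrow> 'c) set" and S :: "'c set"
  where
    base: "x \<in> S \<Longrightarrow> x \<in> generated ops S"
  | step: "\<lbrakk>f \<in> ops; x \<in> generated ops S; y \<in> generated ops S\<rbrakk> \<Longrightarrow> f x y \<in> generated ops S"

lemma lepoll_iff_ordLeq:
  includes cardinal_syntax
  shows "X \<lesssim> Y \<longleftrightarrow> |X| \<le>o |Y|"
  unfolding lepoll_def card_of_ordLeq[symmetric] ..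

text \<open>An infinite cardinal absorbs squares as well as finite and countable unions, and the
  closure is a countable union of levels.\<close>

lemma generated_lepoll:
  includes cardinal_syntax
  fixes S :: "'c set"
  assumes inf: "infinite (UNIV :: 'b set)"
    and S: "S \<lesssim> (UNIV :: 'b set)" and ops: "finite ops"
  shows "generated ops S \<lesssim> (UNIV :: 'b set)"
proof -
  \<comment> \<open>\<open>lev n\<close> collects the values of terms of depth at most
    \<open>n\<close> over \<open>S\<close>.\<close>
  define lev where "lev = rec_nat S (\<lambda>_ L. L \<union> (\<Union>f\<in>ops. (\<lambda>(x, y). f x y) ` (L \<times> L)))"
  have lev_0: "lev 0 = S"
    and lev_Suc: "lev (Suc n) = lev n \<union> (\<Union>f\<in>ops. (\<lambda>(x, y). f x y) ` (lev n \<times> lev n))" for n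
    by (simp_all add: lev_def)
  let ?U = "UNIV :: 'b set"
  have S': "|S| \<le>o |?U|"
    using S by (simp add: lepoll_iff_ordLeq)
  have ops': "|ops| \<le>o |?U|"
    using finite_lepoll_infinite[OF inf ops] by (simp add: lepoll_iff_ordLeq)
  have lev_le: "|lev n| \<le>o |?U|" for n
  proof (induction n)
    case 0
    then show ?case using S' by (simp add: lev_0)
  next
    case (Suc n)
    have "|lev n \<times> lev n| \<le>o |?U|"
      by (rule card_of_Times_ordLeq_infinite_Field)
        (use inf Suc card_of_Card_order in \<open>simp_all add: Field_card_of\<close>)
    then have "|(\<lambda>(x, y). f x y) ` (lev n \<times> lev n)| \<le>o |?U|" for f :: "'c \<Rightarrow> 'c \<Rightarrow> 'c"
      by (rule ordLeq_transitive[OF card_of_image])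
    then have "|\<Union>f\<in>ops. (\<lambda>(x, y). f x y) ` (lev n \<times> lev n)| \<le>o |?U|"
      by (intro card_of_UNION_ordLeq_infinite[OF inf ops'] ballI)
    then show ?case
      unfolding lev_Suc using inf Suc card_of_Card_order
      by (intro card_of_Un_ordLeq_infinite_Field) (simp_all add: Field_card_of)
  qed
  have mono: "lev m \<subseteq> lev n" if "m \<le> n" for m n
    by (rule lift_Suc_mono_le[OF _ that]) (simp add: lev_Suc)
  have "generated ops S \<subseteq> (\<Union>n. lev n)"
  proof
    fix x assume "x \<in> generated ops S"
    then show "x \<in> (\<Union>n. lev n)"
    proof induction
      case (base x)
      then show ?case using lev_0 by blast
    next
      case (step f x y)
      then obtain m n where "x \<in> lev m" "y \<in> lev n" by blast
      then have "x \<in> lev (max m n)" "y \<in> lev (max m n)"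
        using mono[of m "max m n"] mono[of n "max m n"] by auto
      then have "f x y \<in> lev (Suc (max m n))"
        unfolding lev_Suc using step.hyps(1) by (intro UnI2 UN_I image_eqI[of _ _ "(x, y)"]) auto
      then show ?case by blast
    qed
  qed
  moreover have "|\<Union>n. lev n| \<le>o |?U|"
    using inf lev_le
    by (intro card_of_UNION_ordLeq_infinite) (simp_all flip: infinite_iff_card_of_nat)
  ultimately show ?thesis
    unfolding lepoll_iff_ordLeq by (rule ordLeq_transitive[OF card_of_mono1])
qed

section \<open>Germs at the bottom of \<open>Rad A\<close> and their retraction onto
  \<open>A\<close>\<close>

theorem theorem7p5:
  fixes E :: "(rl_term \<times> rl_term) set"
    and A :: "'a rl_alg"
  assumes "infinite (UNIV :: 'b set)"
    and "carrier A \<lesssim> (UNIV :: 'b set)"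
    and "absolute_retract TYPE('b) E A"
  shows "\<exists>e. principal_unity A e"
proof -
  have sub: "in_subvariety E A" and mtl: "mtl_algebra A"
    using assms(3) by (auto simp: absolute_retract_def in_subvariety_def)
  interpret mtl_algebra A by fact
  have Rad_carrier: "x \<in> Rad A \<Longrightarrow> x \<in> carrier A" for x
    by (simp add: Rad_def)
  define F where "F = (INF a\<in>Rad A. principal {x \<in> Rad A. x \<preceq>\<^bsub>A\<^esub> a})"
  have ev_F: "eventually Q F \<longleftrightarrow> (\<exists>a\<in>Rad A. \<forall>x\<in>Rad A. x \<preceq>\<^bsub>A\<^esub> a \<longrightarrow> Q x)" for Q
  proof -
    \<comment> \<open>Down-directedness: the product of two unities is a unity below both.\<close>
    have "\<exists>c\<in>Rad A. principal {x \<in> Rad A. x \<preceq>\<^bsub>A\<^esub> c}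
        \<le> inf (principal {x \<in> Rad A. x \<preceq>\<^bsub>A\<^esub> a}) (principal {x \<in> Rad A. x \<preceq>\<^bsub>A\<^esub> b})"
      if "a \<in> Rad A" "b \<in> Rad A" for a b
      using that Rad_mult_closed[of a b] Rad_carrier
        le_trans[OF _ mult_le_left[of a b]] le_trans[OF _ mult_le_right[of a b]]
      by (intro bexI[of _ "a \<otimes>\<^bsub>A\<^esub> b"]) auto
    then show ?thesis
      unfolding F_def using one_in_Rad
      by (subst eventually_INF_base) (auto simp: eventually_principal)
  qed
  have F_nontriv: "F \<noteq> bot"
    using ev_F[of "\<lambda>_. False"] Rad_carrier le_refl by (auto simp flip: eventually_False)
  \<comment> \<open>The filter \<open>F\<close> ignores indices outside \<open>Rad A\<close>; the
    default value 1 there makes every value of \<open>u\<close> a unity, as \<open>Rad_B\<close>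
    requires.\<close>
  define u where "u x = (if x \<in> Rad A then x else \<one>\<^bsub>A\<^esub>)" for x
  have u_Rad: "u x \<in> Rad A" for x
    by (simp add: u_def one_in_Rad)
  define ops :: "(('a \<Rightarrow> 'a) \<Rightarrow> ('a \<Rightarrow> 'a) \<Rightarrow> 'a \<Rightarrow> 'a) set" where
    "ops = (\<lambda>f p q i. f (p i) (q i)) ` {mult A, rl_meet A, rl_join A, rl_imp A}"
  define P where "P = generated ops (insert u ((\<lambda>a _. a) ` carrier A))"
  let ?C = "(\<lambda>a (_ :: 'a). a) ` carrier A"
  have "insert u ?C \<lesssim> (UNIV :: 'b set)"
  proof (cases "finite ?C")
    case True
    then show ?thesis
      using assms(1) by (intro finite_lepoll_infinite) auto
  next
    case False
    then show ?thesis
      using assms(2) by (meson image_lepoll infinite_insert_lepoll lepoll_trans)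
  qed
  then have "P \<lesssim> (UNIV :: 'b set)"
    unfolding P_def using assms(1) by (intro generated_lepoll) (auto simp: ops_def)
  then obtain g :: "('a \<Rightarrow> 'a) \<Rightarrow> 'b" where g: "inj_on g P"
    by (auto simp: lepoll_def)
  \<comment> \<open>\<open>g\<close> is injective on functions, not on germs, so it is applied to a
    representative chosen for each germ. Functions with the same germ define the same predicate and
    hence get the same representative.\<close>
  define h where "h p = g (SOME q. q \<in> P \<and> (\<forall>\<^sub>F i in F. p i = q i))" for p
  have h_eq_iff: "h p = h q \<longleftrightarrow> (\<forall>\<^sub>F i in F. p i = q i)" if "p \<in> P" "q \<in> P" for p q
  proof
    let ?c = "\<lambda>p. SOME q. q \<in> P \<and> (\<forall>\<^sub>F i in F. p i = q i)"
    have c: "?c p \<in> P \<and> (\<forall>\<^sub>F i in F. p i = ?c p i)" if "p \<in> P" for p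
      using that by (intro someI[of "\<lambda>q. q \<in> P \<and> (\<forall>\<^sub>F i in F. p i = q i)" p]) simp
    {
      assume "h p = h q"
      then have "?c p = ?c q"
        using g c that unfolding h_def by (auto dest: inj_onD)
      then show "\<forall>\<^sub>F i in F. p i = q i"
        using c[OF that(1)] c[OF that(2)] by (auto elim: eventually_elim2)
    next
      assume eq: "\<forall>\<^sub>F i in F. p i = q i"
      have "(\<forall>\<^sub>F i in F. p i = r i) \<longleftrightarrow> (\<forall>\<^sub>F i in F. q i = r i)" for r
        using eq by (auto elim: eventually_elim2)
      then show "h p = h q"
        by (simp add: h_def)
    }
  qed
  have P_carrier: "p i \<in> carrier A" if "p \<in> P" for p i
    using that unfolding P_def
    by (induction arbitrary: i)
      (auto simp: ops_def Rad_carrier u_Rad meet_closed join_closed imp_closed)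
  have P_op: "(\<lambda>i. f (p i) (q i)) \<in> P"
    if "f \<in> {mult A, rl_meet A, rl_join A, rl_imp A}" "p \<in> P" "q \<in> P" for f p q
    using generated.step[of "\<lambda>p q i. f (p i) (q i)" ops p _ q] that unfolding P_def ops_def by blast
  have P_const: "(\<lambda>_. a) \<in> P" if "a \<in> carrier A" for a
    using that by (auto simp: P_def intro: generated.base)
  interpret R: reduced_power A F P h
    by unfold_locales
      (auto simp: P_carrier h_eq_iff P_op P_const)
  have u_P: "u \<in> P"
    by (auto simp: P_def intro: generated.base)
  obtain r where r: "r \<in> rl_hom R.B A" "\<And>x. x \<in> carrier A \<Longrightarrow> r (h (\<lambda>_. x)) = x"
    using assms(3) R.in_subvariety_B[OF sub] R.const_hom R.inj_on_const[OF F_nontriv]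
    unfolding absolute_retract_def by blast
  have "r (h u) \<in> Rad A"
    using r(1) R.residuated_lattice_B R.Rad_B[OF mtl u_P u_Rad] by (rule rl_hom_Rad)
  moreover have "r (h u) \<preceq>\<^bsub>A\<^esub> a" if a: "a \<in> Rad A" for a
  proof -
    \<comment> \<open>The basic set of unities below \<open>a\<close> witnesses this, since
      \<open>u\<close> is the identity on it.\<close>
    have "\<forall>\<^sub>F i in F. u i \<preceq>\<^bsub>A\<^esub> a"
      unfolding ev_F using a by (auto simp: u_def)
    then have "h u \<preceq>\<^bsub>R.B\<^esub> h (\<lambda>_. a)"
      using a u_P by (simp add: R.le_B R.P_const Rad_carrier)
    moreover have "h u \<in> carrier R.B" "h (\<lambda>_. a) \<in> carrier R.B"
      using a u_P by (auto simp: R.carrier_B R.P_const Rad_carrier)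
    \<comment> \<open>The order is a meet equation, so \<open>r\<close> preserves it.\<close>
    ultimately have "r (h u) \<preceq>\<^bsub>A\<^esub> r (h (\<lambda>_. a))"
      using r(1) unfolding rl_hom_def rl_le_def by auto metis
    then show ?thesis
      using r(2) a Rad_carrier by simp
  qed
  \<comment> \<open>A least unity is principal because \<open>Rad A\<close> is upward
    closed.\<close>
  ultimately have "principal_unity A (r (h u))"
    unfolding principal_unity_def using is_unity_mono by (auto simp: Rad_def)
  then show ?thesis ..
qed

end
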